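(* For every integer $n\ge1$ and every $S\in\{\{g,o\},\{r,s\},\{b,y\}\}$, \[F(J(T_n(S)),q)=\prod_{j=1}^{n}{n\brack j}_q=\prod_{1\le i\le j\le k\le n-1}\frac{[j+1]_q}{[j]_q}.\]
   Context: For an integer $n\ge1$, let $T_n$ be the set of triples $(c_1,c_2,c_3)$ of nonnegative integers with $c_1+c_2+c_3\le n-2$. Six colors are associated to vectors: red $r=(1,0,0)$, green $g=(0,1,0)$, yellow $y=(0,0,1)$, blue $b=(-1,1,0)$, orange $o=(-1,0,1)$, silver $s=(0,1,-1)$. For $S\subseteq\{r,b,g,o,y,s\}$, $T_n(S)$ is the poset on $T_n$ whose order relation is the reflexive–transitive closure of the relations $u<u+v$ for all $u,u+v\in T_n$ and $v$ the vector of a color in $S$. $J(P)$ denotes the set of order ideals of a poset $P$ and $F(J(P),q)=\sum_{I\in J(P)}q^{|I|}$. Also $[m]_q=1+q+\dots+q^{m-1}$, $m!_q=[1]_q\cdots[m]_q$, and ${n\brack j}_q=\frac{n!_q}{j!_q\,(n-j)!_q}$. *)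

theory Defs
  imports
    "HOL-Library.Product_Plus"
    "HOL-Computational_Algebra.Polynomial"
    "HOL-Computational_Algebra.Fraction_Field"
begin

datatype color = Red | Green | Yellow | Blue | Orange | Silver

fun color_vec :: "color \<Rightarrow> int \<times> int \<times> int" where
  "color_vec Red = (1, 0, 0)"
| "color_vec Green = (0, 1, 0)"
| "color_vec Yellow = (0, 0, 1)"
| "color_vec Blue = (-1, 1, 0)"
| "color_vec Orange = (-1, 0, 1)"
| "color_vec Silver = (0, 1, -1)"

text \<open>The bound \<open>n - 2\<close> is an integer subtraction, so \<open>T_set 1\<close> is empty.\<close>

definition T_set :: "nat \<Rightarrow> (int \<times> int \<times> int) set" where
  "T_set n = {(c1, c2, c3). 0 \<le> c1 \<and> 0 \<le> c2 \<and> 0 \<le> c3 \<and> c1 + c2 + c3 \<le> int n - 2}"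

definition T_step :: "nat \<Rightarrow> color set \<Rightarrow> (int \<times> int \<times> int) rel" where
  "T_step n S = {(u, w). u \<in> T_set n \<and> w \<in> T_set n \<and> (\<exists>c\<in>S. w = u + color_vec c)}"

text \<open>HOL's \<open>\<^sup>*\<close> is reflexive on the whole type, hence the restriction to \<open>T_set n\<close>.\<close>

definition T_order :: "nat \<Rightarrow> color set \<Rightarrow> (int \<times> int \<times> int) rel" where
  "T_order n S = (T_step n S)\<^sup>* \<inter> (T_set n \<times> T_set n)"

lemma partial_order_T_order: "partial_order_on (T_set n) (T_order n S)"
proof -
  define wt :: "int \<times> int \<times> int \<Rightarrow> int" where "wt = (\<lambda>(a, b, c). a + 3 * b + 2 * c)"
  have step: "wt u < wt w" if "(u, w) \<in> T_step n S" for u w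
  proof -
    from that obtain c where "w = u + color_vec c"
      by (auto simp: T_step_def)
    then show ?thesis
      by (cases c; cases u) (auto simp: wt_def)
  qed
  have star: "u = w \<or> wt u < wt w" if "(u, w) \<in> (T_step n S)\<^sup>*" for u w
    using that by induction (auto dest: step)
  have "antisym (T_order n S)"
    by (rule antisymI) (auto simp: T_order_def dest!: star)
  moreover have "trans (T_order n S)"
    by (rule transI) (auto simp: T_order_def)
  moreover have "refl_on (T_set n) (T_order n S)"
    by (auto simp: refl_on_def T_order_def)
  ultimately show ?thesis
    by (auto simp: partial_order_on_def preorder_on_def T_order_def)
qed

definition order_ideals :: "'a set \<Rightarrow> 'a rel \<Rightarrow> 'a set set" where
  "order_ideals P r = {I. I \<subseteq> P \<and> (\<forall>y\<in>I. \<forall>x\<in>P. (x, y) \<in> r \<longrightarrow> x \<in> I)}"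

definition gen_fun :: "'a set set \<Rightarrow> int poly" where
  "gen_fun J = (\<Sum>I\<in>J. monom 1 (card I))"

definition q_int :: "nat \<Rightarrow> int poly" where
  "q_int m = (\<Sum>i<m. monom 1 i)"

definition q_fact :: "nat \<Rightarrow> int poly" where
  "q_fact m = (\<Prod>i=1..m. q_int i)"

lemma q_int_nonzero: "m > 0 \<Longrightarrow> q_int m \<noteq> 0"
proof -
  assume "m > 0"
  have "poly (q_int m) 1 = int m"
    by (simp add: q_int_def poly_sum poly_monom)
  with \<open>m > 0\<close> show ?thesis by auto
qed

lemma q_fact_nonzero: "q_fact m \<noteq> 0"
  by (simp add: q_fact_def q_int_nonzero)

text \<open>
  The quotient is taken in the field of rational functions in \<open>q\<close>. For \<open>j \<le> n\<close> it is
  the Gaussian binomial coefficient.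
\<close>

definition q_binomial :: "nat \<Rightarrow> nat \<Rightarrow> int poly fract" where
  "q_binomial n j = Fraction_Field.Fract (q_fact n) (q_fact j * q_fact (n - j))"

end

theory Submission
  imports Defs "HOL-Computational_Algebra.Polynomial_Factorial"
begin

text \<open>
  For each of the three colour sets, the two colour vectors have a common invariant (for
  \<open>{g, o}\<close> it is \<open>c\<^sub>1 + c\<^sub>3\<close>), so the poset splits into components on which this
  invariant equals \<open>j - 1\<close> for \<open>1 \<le> j < n\<close>. Such a component is a product of two
  chains with \<open>j\<close> and \<open>n - j\<close> elements, and the \<open>q\<close>-Pascal recurrence shows that its
  ideals are counted by the Gaussian binomial coefficient.
\<close>

section \<open>The product formula\<close>

lemma q_fact_0 [simp]: "q_fact 0 = 1"
  by (simp add: q_fact_def)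

lemma q_fact_Suc: "q_fact (Suc m) = q_int (Suc m) * q_fact m"
  by (simp add: q_fact_def mult.commute)

lemma Fract_eq_divide: "Fraction_Field.Fract a b = to_fract a / to_fract b"
  by (simp add: to_fract_def)

lemma to_fract_prod: "to_fract (\<Prod>i\<in>A. f i) = (\<Prod>i\<in>A. to_fract (f i))"
  by (induction A rule: infinite_finite_induct) auto

text \<open>Each \<open>x j\<close> with \<open>1 < j \<le> n\<close> gets exponent
  \<open>j - 1\<close> from the preceding factor and \<open>-j\<close> from its own, hence -1
  overall. Only \<open>x (n + 1)\<close> keeps the full exponent \<open>n\<close>.\<close>

lemma prod_telescope_power:
  fixes x :: "nat \<Rightarrow> 'a :: field"
  assumes "\<And>j. j \<ge> 1 \<Longrightarrow> x j \<noteq> 0"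
  shows "(\<Prod>j=1..n. (x (j + 1) / x j) ^ j) = x (n + 1) ^ n / (\<Prod>j=1..n. x j)"
proof (induction n)
  case (Suc n)
  \<comment> \<open>Used with \<open>a = x (n + 1)\<close>, \<open>b = x (n + 2)\<close> and
    \<open>p\<close> the product of the first \<open>n\<close> values. For \<open>p = 0\<close> both
    sides are 0, as division by zero gives 0.\<close>
  have "a ^ n / p * (b / a) ^ Suc n = b ^ Suc n / (p * a)" if "a \<noteq> 0" for a b p :: 'a
    using that by (cases "p = 0") (simp_all add: field_simps)
  from this[of "x (Suc n)"] Suc show ?case
    using assms[of "Suc n"] by (simp del: power_Suc)
qed simp

text \<open>From row \<open>n\<close> to row \<open>n + 1\<close> the \<open>j\<close>-th binomial
  grows by the factor [n+1]/[n+1-j], and the new last entry is 1. Reversing the order of the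
  denominators gives the stated form, which is the right-hand side of
  \<open>prod_telescope_power\<close>.\<close>

lemma prod_q_binomial_Suc:
  "(\<Prod>j=1..Suc n. q_binomial (Suc n) j) =
    (\<Prod>j=1..n. q_binomial n j) * (to_fract (q_int (n + 1)) ^ n / (\<Prod>j=1..n. to_fract (q_int j)))"
proof -
  have nz: "to_fract (q_fact j) \<noteq> 0" "to_fract (q_int (Suc j)) \<noteq> 0" for j
    by (simp_all add: q_fact_nonzero q_int_nonzero)
  have step: "q_binomial (Suc n) j =
      q_binomial n j * (to_fract (q_int (n + 1)) / to_fract (q_int (n + 1 - j)))"
    if "j \<in> {1..n}" for j
  proof -
    from that have "Suc n - j = Suc (n - j)" by auto
    then show ?thesis
      by (simp add: q_binomial_def Fract_eq_divide q_fact_Suc mult_ac)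
  qed
  have "q_binomial (Suc n) (Suc n) = 1"
    using nz by (simp add: q_binomial_def Fract_eq_divide)
  then have "(\<Prod>j=1..Suc n. q_binomial (Suc n) j) = (\<Prod>j=1..n. q_binomial (Suc n) j)"
    by simp
  also have "\<dots> = (\<Prod>j=1..n. q_binomial n j) *
      (to_fract (q_int (n + 1)) ^ n / (\<Prod>j=1..n. to_fract (q_int (n + 1 - j))))"
    by (simp add: step prod.distrib prod_dividef)
  also have "(\<Prod>j=1..n. to_fract (q_int (n + 1 - j))) = (\<Prod>j=1..n. to_fract (q_int j))"
    using prod.atLeastAtMost_rev[of "\<lambda>j. to_fract (q_int j)" 1 n] by simp
  finally show ?thesis .
qed

text \<open>The factor depends on \<open>j\<close> alone, and \<open>i\<close> has \<open>j\<close>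
  choices. With \<open>k\<close> outermost, raising \<open>n\<close> by one adds a single
  telescoping product.\<close>

lemma prod_triples:
  fixes x :: "nat \<Rightarrow> 'a :: comm_monoid_mult"
  shows "(\<Prod>(i, j, k) \<in> {(i, j, k). 1 \<le> i \<and> i \<le> j \<and> j \<le> k \<and> k \<le> n}. x j) =
    (\<Prod>k=1..n. \<Prod>j=1..k. x j ^ j)"
proof -
  let ?A = "SIGMA k:{1..n}. SIGMA j:{1..k}. {1..j}"
  have "(\<Prod>k=1..n. \<Prod>j=1..k. x j ^ j) = (\<Prod>k=1..n. \<Prod>j=1..k. \<Prod>i=1..j. x j)"
    by simp
  also have "\<dots> = (\<Prod>(k, j, i)\<in>?A. x j)"
    by (simp add: prod.Sigma del: prod_constant)
  also have "\<dots> = (\<Prod>(i, j, k) \<in> {(i, j, k). 1 \<le> i \<and> i \<le> j \<and> j \<le> k \<and> k \<le> n}. x j)"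
    by (rule prod.reindex_bij_witness[of _ "\<lambda>(i, j, k). (k, j, i)" "\<lambda>(k, j, i). (i, j, k)"]) auto
  finally show ?thesis ..
qed

lemma prod_q_binomial_eq:
  assumes "n \<ge> 1"
  shows "(\<Prod>j=1..n. q_binomial n j) =
    (\<Prod>(i, j, k) \<in> {(i, j, k). 1 \<le> i \<and> i \<le> j \<and> j \<le> k \<and> k \<le> n - 1}.
      Fraction_Field.Fract (q_int (j + 1)) (q_int j))"
proof -
  have "(\<Prod>j=1..Suc m. q_binomial (Suc m) j) =
      (\<Prod>k=1..m. \<Prod>j=1..k. (to_fract (q_int (j + 1)) / to_fract (q_int j)) ^ j)" for m
  proof (induction m)
    case 0
    show ?case
      by (simp add: q_binomial_def Fract_eq_divide q_fact_nonzero)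
  next
    case (Suc m)
    \<comment> \<open>The new factor for \<open>k = m + 1\<close> is exactly the growth from row
      \<open>m + 1\<close> to row \<open>m + 2\<close>.\<close>
    have tele: "(\<Prod>j=1..Suc m. (to_fract (q_int (j + 1)) / to_fract (q_int j)) ^ j) =
        to_fract (q_int (Suc m + 1)) ^ Suc m / (\<Prod>j=1..Suc m. to_fract (q_int j))"
      by (rule prod_telescope_power) (simp add: q_int_nonzero)
    show ?case
      unfolding prod_q_binomial_Suc[of "Suc m"] Suc.IH tele[symmetric] by simp
  qed
  from this[of "n - 1"] show ?thesis
    unfolding Fract_eq_divide prod_triples using assms by simp
qed

section \<open>Generating functions of order ideals\<close>

lemma finite_order_ideals: "finite P \<Longrightarrow> finite (order_ideals P r)"
  by (rule finite_subset[of _ "Pow P"]) (auto simp: order_ideals_def)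

text \<open>Membership in an ideal passes backwards along a path of steps inside \<open>P\<close>,
  one step at a time. Hence ideals can be studied through generating steps instead of their
  transitive closure.\<close>

lemma order_ideals_rtrancl: "order_ideals P ((r \<inter> P \<times> P)\<^sup>* \<inter> P \<times> P) = order_ideals P r"
proof
  show "order_ideals P ((r \<inter> P \<times> P)\<^sup>* \<inter> P \<times> P) \<subseteq> order_ideals P r"
    unfolding order_ideals_def by blast
next
  have closed: "x \<in> I" if "(x, y) \<in> (r \<inter> P \<times> P)\<^sup>*" "I \<in> order_ideals P r" "y \<in> I" for x y I
    using that by (induction rule: converse_rtrancl_induct) (auto simp: order_ideals_def)
  show "order_ideals P r \<subseteq> order_ideals P ((r \<inter> P \<times> P)\<^sup>* \<inter> P \<times> P)"
  proof
    fix I assume I: "I \<in> order_ideals P r"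
    then show "I \<in> order_ideals P ((r \<inter> P \<times> P)\<^sup>* \<inter> P \<times> P)"
      using closed[OF _ I] by (auto simp: order_ideals_def)
  qed
qed

text \<open>Taking images under \<open>f\<close> is a size-preserving bijection between ideals. The
  relations are arbitrary, so that the lemma applies to step relations as well as to orders.\<close>

lemma gen_fun_order_ideals_image:
  assumes inj: "inj_on f A"
    and iso: "\<And>x y. x \<in> A \<Longrightarrow> y \<in> A \<Longrightarrow> (f x, f y) \<in> s \<longleftrightarrow> (x, y) \<in> r"
  shows "gen_fun (order_ideals (f ` A) s) = gen_fun (order_ideals A r)"
proof -
  have eq: "order_ideals (f ` A) s = (`) f ` order_ideals A r"
  proof (intro equalityI subsetI)
    fix I assume I: "I \<in> order_ideals (f ` A) s"
    define K where "K = {x \<in> A. f x \<in> I}"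
    have "I = f ` K"
      using I by (auto simp: order_ideals_def K_def)
    moreover have "K \<in> order_ideals A r"
      using I iso by (auto simp: order_ideals_def K_def)
    ultimately show "I \<in> (`) f ` order_ideals A r" by blast
  next
    fix I assume "I \<in> (`) f ` order_ideals A r"
    then obtain K where K: "K \<in> order_ideals A r" "I = f ` K" by blast
    show "I \<in> order_ideals (f ` A) s"
      using K iso unfolding order_ideals_def by blast
  qed
  have inj': "inj_on ((`) f) (order_ideals A r)"
    using inj by (intro inj_onI) (auto simp: order_ideals_def inj_on_image_eq_iff)
  have "card (f ` K) = card K" if "K \<in> order_ideals A r" for K
    using that inj by (intro card_image) (auto simp: order_ideals_def intro: inj_on_subset)
  then show ?thesis
    by (simp add: gen_fun_def eq sum.reindex[OF inj'])
qed

text \<open>With no relation across the two parts, an ideal of the union is an independent choice of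
  an ideal in each. Sizes add, so monomials multiply.\<close>

lemma gen_fun_order_ideals_Un:
  assumes fin: "finite A" "finite B" and disj: "A \<inter> B = {}"
    and sep: "r \<inter> (A \<times> B \<union> B \<times> A) = {}"
  shows "gen_fun (order_ideals (A \<union> B) r) =
    gen_fun (order_ideals A r) * gen_fun (order_ideals B r)"
proof -
  let ?u = "\<lambda>(I, K). I \<union> K"
  let ?X = "order_ideals A r \<times> order_ideals B r"
  have eq: "order_ideals (A \<union> B) r = ?u ` ?X"
  proof (intro equalityI subsetI)
    fix I assume I: "I \<in> order_ideals (A \<union> B) r"
    have "I \<inter> A \<in> order_ideals A r" "I \<inter> B \<in> order_ideals B r"
      using I by (auto simp: order_ideals_def)
    moreover have "I = I \<inter> A \<union> I \<inter> B"
      using I by (auto simp: order_ideals_def)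
    ultimately show "I \<in> ?u ` ?X" by (intro image_eqI[of _ _ "(I \<inter> A, I \<inter> B)"]) auto
  next
    fix I assume "I \<in> ?u ` ?X"
    then obtain K L where "K \<in> order_ideals A r" "L \<in> order_ideals B r" "I = K \<union> L" by auto
    then show "I \<in> order_ideals (A \<union> B) r"
      using sep unfolding order_ideals_def by blast
  qed
  have inj: "inj_on ?u ?X"
    by (rule inj_on_inverseI[of _ "\<lambda>J. (J \<inter> A, J \<inter> B)"])
      (use disj in \<open>auto simp: order_ideals_def\<close>)
  have card: "card (I \<union> K) = card I + card K"
    if "I \<in> order_ideals A r" "K \<in> order_ideals B r" for I K
  proof -
    have "I \<subseteq> A" "K \<subseteq> B"
      using that by (simp_all add: order_ideals_def)
    with fin disj show ?thesis
      by (meson card_Un_disjoint disjoint_iff finite_subset subsetD)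
  qed
  have "gen_fun (order_ideals (A \<union> B) r) = (\<Sum>(I, K)\<in>?X. monom 1 (card (I \<union> K)))"
    unfolding gen_fun_def eq sum.reindex[OF inj] by (simp add: case_prod_unfold)
  also have "\<dots> = (\<Sum>(I, K)\<in>?X. monom 1 (card I) * monom 1 (card K))"
    by (intro sum.cong) (auto simp: card mult_monom)
  also have "\<dots> = gen_fun (order_ideals A r) * gen_fun (order_ideals B r)"
    by (simp add: gen_fun_def sum_product sum.cartesian_product)
  finally show ?thesis .
qed

lemma order_ideals_empty [simp]: "order_ideals {} r = {{}}"
  by (auto simp: order_ideals_def)

lemma gen_fun_singleton_empty [simp]: "gen_fun {{}} = 1"
  by (simp add: gen_fun_def monom_0 one_pCons)

lemma gen_fun_order_ideals_UN:
  assumes "finite M" and "\<And>i. i \<in> M \<Longrightarrow> finite (P i)"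
    and "\<And>i j. i \<in> M \<Longrightarrow> j \<in> M \<Longrightarrow> i \<noteq> j \<Longrightarrow> P i \<inter> P j = {}"
    and "\<And>i j. i \<in> M \<Longrightarrow> j \<in> M \<Longrightarrow> i \<noteq> j \<Longrightarrow> r \<inter> P i \<times> P j = {}"
  shows "gen_fun (order_ideals (\<Union>i\<in>M. P i) r) = (\<Prod>i\<in>M. gen_fun (order_ideals (P i) r))"
  using assms
proof (induction M rule: finite_induct)
  case (insert k M)
  have "P k \<inter> (\<Union>i\<in>M. P i) = {}"
    using insert.hyps insert.prems(2) by blast
  moreover have "r \<inter> (P k \<times> (\<Union>i\<in>M. P i) \<union> (\<Union>i\<in>M. P i) \<times> P k) = {}"
  proof -
    have "r \<inter> P k \<times> P i = {}" "r \<inter> P i \<times> P k = {}" if "i \<in> M" for i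
      using that insert.hyps insert.prems(3) by auto
    then show ?thesis by blast
  qed
  ultimately have "gen_fun (order_ideals (P k \<union> (\<Union>i\<in>M. P i)) r) =
      gen_fun (order_ideals (P k) r) * gen_fun (order_ideals (\<Union>i\<in>M. P i) r)"
    using insert.hyps insert.prems(1) by (intro gen_fun_order_ideals_Un) auto
  also have "gen_fun (order_ideals (\<Union>i\<in>M. P i) r) = (\<Prod>i\<in>M. gen_fun (order_ideals (P i) r))"
    using insert.prems by (intro insert.IH) auto
  finally show ?case
    using insert.hyps by simp
qed simp

section \<open>Products of two chains\<close>

definition grid_le :: "(nat \<times> nat) rel" where
  "grid_le = {((a, b), (a', b')). a \<le> a' \<and> b \<le> b'}"

text \<open>The covering relation of \<open>grid_le\<close>. Colour vectors correspond to such unit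
  steps, while the count of ideals uses the full order.\<close>

definition grid_step :: "(nat \<times> nat) rel" where
  "grid_step = {((a, b), (a', b')). a' = Suc a \<and> b' = b \<or> a' = a \<and> b' = Suc b}"

abbreviation grid :: "nat \<Rightarrow> nat \<Rightarrow> (nat \<times> nat) set" where
  "grid a b \<equiv> {..<a} \<times> {..<b}"

lemma grid_ideal_down:
  assumes "I \<in> order_ideals (grid a b) grid_le" "(x, y) \<in> I" "x' \<le> x" "y' \<le> y"
  shows "(x', y') \<in> I"
proof -
  have "(x', y') \<in> grid a b"
    using assms by (force simp: order_ideals_def)
  then show ?thesis
    using assms unfolding order_ideals_def grid_le_def by blast
qed

lemma grid_idealI:
  assumes "I \<subseteq> grid a b"
    and "\<And>x y x' y'. (x, y) \<in> I \<Longrightarrow> x' \<le> x \<Longrightarrow> y' \<le> y \<Longrightarrow> (x', y') \<in> I"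
  shows "I \<in> order_ideals (grid a b) grid_le"
  using assms by (auto simp: order_ideals_def grid_le_def)

lemma order_ideals_grid_step: "order_ideals (grid a b) grid_step = order_ideals (grid a b) grid_le"
proof
  show "order_ideals (grid a b) grid_le \<subseteq> order_ideals (grid a b) grid_step"
    by (fastforce simp: order_ideals_def grid_le_def grid_step_def)
next
  show "order_ideals (grid a b) grid_step \<subseteq> order_ideals (grid a b) grid_le"
  proof
    fix I assume I: "I \<in> order_ideals (grid a b) grid_step"
    then have sub: "I \<subseteq> grid a b" by (simp add: order_ideals_def)
    have left: "(x, y) \<in> I" if "(Suc x, y) \<in> I" for x y
      using that I by (force simp: order_ideals_def grid_step_def)
    have down: "(x, y) \<in> I" if "(x, Suc y) \<in> I" for x y
      using that I by (force simp: order_ideals_def grid_step_def)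
    have "(x', y') \<in> I" if "(x, y) \<in> I" "x' \<le> x" "y' \<le> y" for x y x' y'
    proof -
      \<comment> \<open>Walk from \<open>(x, y)\<close> horizontally to \<open>(x', y)\<close>, then
        vertically to \<open>(x', y')\<close>.\<close>
      have "(x', y) \<in> I"
        using that(2,1) by (induction rule: inc_induct) (auto intro: left)
      with that(3) show ?thesis
        by (induction rule: inc_induct) (auto intro: down)
    qed
    with sub show "I \<in> order_ideals (grid a b) grid_le"
      by (rule grid_idealI)
  qed
qed

text \<open>
  An ideal either avoids the corner \<open>(a, 0)\<close>, and hence the whole last column, or contains
  the whole bottom row.
\<close>

lemma grid_ideals_Suc_Suc:
  "order_ideals (grid (Suc a) (Suc b)) grid_le =
    order_ideals (grid a (Suc b)) grid_le \<union>
    (\<lambda>I. {..a} \<times> {0} \<union> map_prod id Suc ` I) ` order_ideals (grid (Suc a) b) grid_le"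
  (is "?L = ?A \<union> ?h ` ?B")
proof (intro equalityI subsetI)
  fix I assume I: "I \<in> ?L"
  note down = grid_ideal_down[OF I]
  from I have sub: "I \<subseteq> grid (Suc a) (Suc b)" by (simp add: order_ideals_def)
  show "I \<in> ?A \<union> ?h ` ?B"
  proof (cases "(a, 0) \<in> I")
    case False
    \<comment> \<open>A point with \<open>x \<ge> a\<close> would force \<open>(a, 0)\<close>, which
      lies below it, into \<open>I\<close>.\<close>
    have "x < a" if "(x, y) \<in> I" for x y
      using False down[OF that, of a 0] by (meson le0 linorder_not_less)
    with sub have "I \<subseteq> grid a (Suc b)" by auto
    then have "I \<in> ?A"
      using down by (rule grid_idealI)
    then show ?thesis ..
  next
    case True
    \<comment> \<open>\<open>K\<close> is the part of \<open>I\<close> above the bottom row, moved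
      down by one. The bottom row itself is full, since all its points lie below
      \<open>(a, 0)\<close>.\<close>
    define K where "K = {(x, y). (x, Suc y) \<in> I}"
    have "K \<in> ?B"
      using sub by (intro grid_idealI) (auto simp: K_def intro: down)
    moreover have "I = ?h K"
    proof (intro equalityI subsetI)
      fix p assume p: "p \<in> I"
      obtain x y where [simp]: "p = (x, y)" by (cases p)
      show "p \<in> ?h K"
        using p sub by (cases y) (force simp: K_def)+
    next
      fix p assume "p \<in> ?h K"
      then show "p \<in> I"
        using down[OF True] by (auto simp: K_def)
    qed
    ultimately show ?thesis by blast
  qed
next
  fix I assume "I \<in> ?A \<union> ?h ` ?B"
  then show "I \<in> ?L"
  proof
    assume "I \<in> ?A"
    then show ?thesis
      by (intro grid_idealI) (auto simp: order_ideals_def intro: grid_ideal_down)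
  next
    assume "I \<in> ?h ` ?B"
    then obtain K where K: "K \<in> ?B" "I = ?h K" by blast
    have mem: "(x, y) \<in> I \<longleftrightarrow> y = 0 \<and> x \<le> a \<or> (\<exists>z. y = Suc z \<and> (x, z) \<in> K)" for x y
      by (force simp: K(2))
    note down = grid_ideal_down[OF K(1)]
    from K(1) have sub: "K \<subseteq> grid (Suc a) b" by (simp add: order_ideals_def)
    have "(x', y') \<in> I" if "(x, y) \<in> I" "x' \<le> x" "y' \<le> y" for x y x' y'
    proof (cases y')
      case 0
      then show ?thesis using that sub by (auto simp: mem)
    next
      case (Suc z)
      then show ?thesis using that down by (auto simp: mem Suc_le_eq less_Suc_eq_le)
    qed
    moreover have "I \<subseteq> grid (Suc a) (Suc b)"
      using sub by (auto simp: mem)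
    ultimately show ?thesis
      by (intro grid_idealI)
  qed
qed

definition grid_gen :: "nat \<Rightarrow> nat \<Rightarrow> int poly" where
  "grid_gen a b = gen_fun (order_ideals (grid a b) grid_le)"

lemma grid_gen_0 [simp]: "grid_gen 0 b = 1" "grid_gen a 0 = 1"
  by (simp_all add: grid_gen_def)

text \<open>This is the \<open>q\<close>-Pascal recurrence: an ideal of the second kind has a full
  bottom row, whose \<open>a + 1\<close> points account for the monomial.\<close>

lemma grid_gen_Suc_Suc:
  "grid_gen (Suc a) (Suc b) = grid_gen a (Suc b) + monom 1 (Suc a) * grid_gen (Suc a) b"
proof -
  let ?h = "\<lambda>I. {..a} \<times> {0} \<union> map_prod id Suc ` I"
  let ?A = "order_ideals (grid a (Suc b)) grid_le" and ?B = "order_ideals (grid (Suc a) b) grid_le"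
  have inj_map: "inj (map_prod id Suc :: nat \<times> nat \<Rightarrow> _)"
    by (intro prod.inj_map) auto
  \<comment> \<open>Ideals of the second kind contain \<open>(a, 0)\<close>, which lies outside
    \<open>grid a (Suc b)\<close>.\<close>
  have disj: "?A \<inter> ?h ` ?B = {}"
    by (auto simp: order_ideals_def)
  have "inj ?h"
  proof (rule injI)
    fix I K :: "(nat \<times> nat) set"
    assume "?h I = ?h K"
    \<comment> \<open>Deleting row 0 leaves only the lifted copy, which determines the
      ideal.\<close>
    then have "?h I - UNIV \<times> {0} = ?h K - UNIV \<times> {0}" by simp
    moreover have "?h I - UNIV \<times> {0} = map_prod id Suc ` I" for I :: "(nat \<times> nat) set"
      by auto
    ultimately show "I = K"
      using inj_map by (simp add: inj_image_eq_iff)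
  qed
  then have inj: "inj_on ?h ?B" by (rule inj_on_subset) simp
  have card: "card (?h I) = Suc a + card I" if "I \<in> ?B" for I
  proof -
    have "I \<subseteq> grid (Suc a) b"
      using that by (simp add: order_ideals_def)
    then have fin: "finite I"
      by (rule finite_subset) simp
    have "card (?h I) = card ({..a} \<times> {0::nat}) + card (map_prod id Suc ` I)"
      using fin by (intro card_Un_disjoint) auto
    then show ?thesis
      using inj_map by (simp add: card_cartesian_product card_image inj_on_subset)
  qed
  have "grid_gen (Suc a) (Suc b) = grid_gen a (Suc b) + (\<Sum>I\<in>?B. monom 1 (card (?h I)))"
    unfolding grid_gen_def gen_fun_def grid_ideals_Suc_Suc
    by (subst sum.union_disjoint)
      (use disj in \<open>auto simp: sum.reindex[OF inj] finite_order_ideals\<close>)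
  also have "(\<Sum>I\<in>?B. monom 1 (card (?h I))) = monom 1 (Suc a) * grid_gen (Suc a) b"
    unfolding grid_gen_def gen_fun_def sum_distrib_left
    by (intro sum.cong) (simp_all add: card mult_monom)
  finally show ?thesis .
qed

lemma q_int_add: "q_int (a + b) = q_int a + monom 1 a * q_int b"
proof -
  have "q_int (a + b) = q_int a + (\<Sum>i<b. monom 1 (a + i))"
    unfolding q_int_def by (induction b) (auto simp: add.assoc)
  then show ?thesis
    by (simp add: q_int_def sum_distrib_left mult_monom)
qed

text \<open>Denominators are cleared so that the induction stays among polynomials. Pulling [a] out
  of one summand of the recurrence and [b] out of the other leaves the same factorial in both, and
  \<open>q_int_add\<close> merges the coefficients into [a+b].\<close>

lemma grid_gen_q_fact: "grid_gen a b * (q_fact a * q_fact b) = q_fact (a + b)"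
proof (induction "a + b" arbitrary: a b)
  case (Suc m)
  show ?case
  proof (cases a; cases b)
    fix c d assume [simp]: "a = Suc c" "b = Suc d"
    have "grid_gen a b * (q_fact a * q_fact b) =
        q_int (Suc c) * (grid_gen c (Suc d) * (q_fact c * q_fact (Suc d))) +
        monom 1 (Suc c) * q_int (Suc d) * (grid_gen (Suc c) d * (q_fact (Suc c) * q_fact d))"
      by (simp add: grid_gen_Suc_Suc q_fact_Suc algebra_simps)
    also have "grid_gen c (Suc d) * (q_fact c * q_fact (Suc d)) = q_fact (Suc (c + d))"
      using Suc.hyps(1)[of c "Suc d"] Suc.hyps(2) by simp
    also have "grid_gen (Suc c) d * (q_fact (Suc c) * q_fact d) = q_fact (Suc (c + d))"
      using Suc.hyps(1)[of "Suc c" d] Suc.hyps(2) by simp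
    also have "q_int (Suc c) * q_fact (Suc (c + d)) +
        monom 1 (Suc c) * q_int (Suc d) * q_fact (Suc (c + d)) =
        (q_int (Suc c) + monom 1 (Suc c) * q_int (Suc d)) * q_fact (Suc (c + d))"
      by (simp only: distrib_right)
    also have "\<dots> = q_fact (a + b)"
      using q_int_add[of "Suc c" "Suc d"] by (simp add: q_fact_Suc)
    finally show ?thesis .
  qed auto
qed auto

lemma q_binomial_eq_grid_gen:
  assumes "j \<le> n"
  shows "q_binomial n j = to_fract (grid_gen j (n - j))"
  using grid_gen_q_fact[of j "n - j"] assms
  by (simp add: q_binomial_def to_fract_def eq_fract q_fact_nonzero)

lemma prod_q_binomial_eq_grid_gen:
  "(\<Prod>j=1..n. q_binomial n j) = to_fract (\<Prod>j=1..n. grid_gen j (n - j))"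
  by (simp add: to_fract_prod q_binomial_eq_grid_gen)

section \<open>Decomposition into components\<close>

definition color_step :: "color set \<Rightarrow> (int \<times> int \<times> int) rel" where
  "color_step S = {(u, w). \<exists>v\<in>color_vec ` S. w = u + v}"

lemma order_ideals_T_order:
  "order_ideals (T_set n) (T_order n S) = order_ideals (T_set n) (color_step S)"
proof -
  have "T_step n S = color_step S \<inter> T_set n \<times> T_set n"
    by (auto simp: T_step_def color_step_def)
  then show ?thesis
    by (simp add: T_order_def order_ideals_rtrancl)
qed

text \<open>An additive involution that preserves \<open>T_set n\<close> and matches the colour
  vectors is an isomorphism of step relations. It serves to reduce the three colour sets to
  one.\<close>

lemma gen_fun_T_order_cong:
  assumes inv: "\<And>u. \<pi> (\<pi> u) = u" and add: "\<And>u v. \<pi> (u + v) = \<pi> u + \<pi> v"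
    and T: "\<And>u. u \<in> T_set n \<Longrightarrow> \<pi> u \<in> T_set n" and S: "color_vec ` S = \<pi> ` color_vec ` S'"
  shows "gen_fun (order_ideals (T_set n) (T_order n S)) =
    gen_fun (order_ideals (T_set n) (T_order n S'))"
proof -
  have inj: "inj \<pi>"
    by (rule inj_on_inverseI) (rule inv)
  have image: "\<pi> ` T_set n = T_set n"
    using T by (force simp: image_iff inv intro: inv[symmetric])
  have "(\<pi> u, \<pi> w) \<in> color_step S \<longleftrightarrow> (u, w) \<in> color_step S'" for u w
    using inj by (simp add: color_step_def S add[symmetric] inj_eq)
  then have "gen_fun (order_ideals (\<pi> ` T_set n) (color_step S)) =
      gen_fun (order_ideals (T_set n) (color_step S'))"
    using inj by (intro gen_fun_order_ideals_image) (auto intro: inj_on_subset)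
  then show ?thesis
    by (simp add: image order_ideals_T_order)
qed

text \<open>Both vectors preserve the sum of the first two coordinates, which is
  \<open>j - 1\<close> on the component \<open>f j\<close>. There blue raises the second coordinate,
  with \<open>j\<close> possible values, and yellow the third, with \<open>n - j\<close>.\<close>

lemma gen_fun_Blue_Yellow:
  "gen_fun (order_ideals (T_set n) (T_order n {Blue, Yellow})) = (\<Prod>j=1..n. grid_gen j (n - j))"
proof -
  define r where "r = color_step {Blue, Yellow}"
  define f :: "nat \<Rightarrow> nat \<times> nat \<Rightarrow> int \<times> int \<times> int"
    where "f j = (\<lambda>(a, b). (int j - 1 - int a, int a, int b))" for j
  \<comment> \<open>For \<open>j = n\<close> the grid is empty and contributes the factor 1, in
    agreement with the last binomial.\<close>
  have T: "T_set n = (\<Union>j\<in>{1..n}. f j ` grid j (n - j))"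
  proof (intro equalityI subsetI)
    fix u assume "u \<in> T_set n"
    then obtain x y z where "u = (x, y, z)" "0 \<le> x" "0 \<le> y" "0 \<le> z" "x + y + z \<le> int n - 2"
      by (auto simp: T_set_def)
    then show "u \<in> (\<Union>j\<in>{1..n}. f j ` grid j (n - j))"
      by (intro UN_I[of "nat (x + y + 1)"] image_eqI[of _ _ "(nat y, nat z)"]) (auto simp: f_def)
  qed (auto simp: T_set_def f_def)
  have inj: "f j p = f k p' \<longleftrightarrow> j = k \<and> p = p'" for j k p p'
    by (cases p; cases p') (auto simp: f_def)
  have step: "(f j p, f k p') \<in> r \<longleftrightarrow> j = k \<and> (p, p') \<in> grid_step" for j k p p'
    by (cases p; cases p') (auto simp: f_def r_def color_step_def grid_step_def)
  have component: "gen_fun (order_ideals (f j ` grid j (n - j)) r) = grid_gen j (n - j)" for j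
    unfolding grid_gen_def order_ideals_grid_step[symmetric]
    by (rule gen_fun_order_ideals_image) (simp_all add: inj_on_def inj step)
  have "gen_fun (order_ideals (T_set n) r) =
      (\<Prod>j=1..n. gen_fun (order_ideals (f j ` grid j (n - j)) r))"
    unfolding T
  proof (rule gen_fun_order_ideals_UN)
    fix i j :: nat assume "i \<noteq> j"
    then show "f i ` grid i (n - i) \<inter> f j ` grid j (n - j) = {}"
      using inj by blast
    have "(f i p, f j p') \<notin> r" for p p'
      using \<open>i \<noteq> j\<close> by (simp add: step)
    then show "r \<inter> f i ` grid i (n - i) \<times> f j ` grid j (n - j) = {}"
      by blast
  qed auto
  then show ?thesis
    unfolding order_ideals_T_order r_def[symmetric] component .
qed

text \<open>Exchanging the last two coordinates turns blue into orange and yellow into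
  green.\<close>

lemma gen_fun_Green_Orange:
  "gen_fun (order_ideals (T_set n) (T_order n {Green, Orange})) =
    gen_fun (order_ideals (T_set n) (T_order n {Blue, Yellow}))"
  by (rule gen_fun_T_order_cong[where \<pi> = "\<lambda>(x, y, z). (x, z, y)"]) (auto simp: T_set_def)

text \<open>Exchanging the outer coordinates turns blue into silver and yellow into red.\<close>

lemma gen_fun_Red_Silver:
  "gen_fun (order_ideals (T_set n) (T_order n {Red, Silver})) =
    gen_fun (order_ideals (T_set n) (T_order n {Blue, Yellow}))"
  by (rule gen_fun_T_order_cong[where \<pi> = "\<lambda>(x, y, z). (z, y, x)"]) (auto simp: T_set_def)

lemma gen_fun_T_set:
  assumes "S \<in> {{Green, Orange}, {Red, Silver}, {Blue, Yellow}}"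
  shows "gen_fun (order_ideals (T_set n) (T_order n S)) = (\<Prod>j=1..n. grid_gen j (n - j))"
  using assms by (auto simp: gen_fun_Green_Orange gen_fun_Red_Silver gen_fun_Blue_Yellow)

lemma Fract_gen_fun_eq_prod_triples:
  assumes "n \<ge> 1" and "S \<in> {{Green, Orange}, {Red, Silver}, {Blue, Yellow}}"
  shows "Fraction_Field.Fract (gen_fun (order_ideals (T_set n) (T_order n S))) 1
    = (\<Prod>(i, j, k) \<in> {(i, j, k). 1 \<le> i \<and> i \<le> j \<and> j \<le> k \<and> k \<le> n - 1}.
        Fraction_Field.Fract (q_int (j + 1)) (q_int j))"
  unfolding gen_fun_T_set[OF assms(2)] prod_q_binomial_eq[OF assms(1), symmetric]
    prod_q_binomial_eq_grid_gen to_fract_def ..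

theorem theorem2p6:
  fixes n :: nat and S :: "color set"
  assumes "n \<ge> 1"
    and "S \<in> {{Green, Orange}, {Red, Silver}, {Blue, Yellow}}"
  shows "Fraction_Field.Fract (gen_fun (order_ideals (T_set n) (T_order n S))) 1
           = (\<Prod>j=1..n. q_binomial n j)
       \<and> (\<Prod>j=1..n. q_binomial n j)
           = (\<Prod>(i, j, k) \<in> {(i, j, k). 1 \<le> i \<and> i \<le> j \<and> j \<le> k \<and> k \<le> n - 1}.
                Fraction_Field.Fract (q_int (j + 1)) (q_int j))"
  using Fract_gen_fun_eq_prod_triples[OF assms] prod_q_binomial_eq[OF assms(1)]
  by (simp only: simp_thms)

end
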